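(* Let $\kappa=\frac{119}{11}$. Then for every integer $n\ge1$, $P_n^{\sigma}(z)\neq0$ for all complex $z$ with $|z|>\kappa\,(n-1)$.
   Context: Here $\sigma(n)=\sum_{d\mid n}d$ is the sum-of-divisors function. The D'Arcais polynomials $P_n^\sigma(x)$ are defined by $P_0^\sigma(x)=1$ and, for $n\ge1$, $P_n^\sigma(x)=\frac{x}{n}\sum_{k=1}^n\sigma(k)P_{n-k}^\sigma(x)$; equivalently, $\sum_{n=0}^\infty P_n^\sigma(z)q^n=\prod_{n=1}^\infty(1-q^n)^{-z}$ for $z\in\mathbb{C}$. *)

theory Defs
  imports Complex_Main "HOL-Computational_Algebra.Polynomial"
begin

definition sigma :: "nat \<Rightarrow> nat" where
  "sigma n = (\<Sum>d | d dvd n. d)"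

(* [:0, 1:] is the indeterminate. *)
function darcais :: "nat \<Rightarrow> complex poly" where
  "darcais n =
     (if n = 0 then 1
      else smult (1 / of_nat n) [:0, 1:] *
             (\<Sum>k = 1..n. smult (of_nat (sigma k)) (darcais (n - k))))"
  by auto
termination
  by (relation "measure id") auto

declare darcais.simps [simp del]

lemma darcais_0: "darcais 0 = 1"
  by (simp add: darcais.simps)

lemma darcais_rec:
  assumes "n \<ge> 1"
  shows "darcais n = smult (1 / of_nat n) [:0, 1:] *
           (\<Sum>k = 1..n. smult (of_nat (sigma k)) (darcais (n - k)))"
  using assms by (subst darcais.simps) simp

lemma poly_darcais_rec:
  assumes "n \<ge> 1"
  shows "poly (darcais n) z =
           z / of_nat n * (\<Sum>k = 1..n. of_nat (sigma k) * poly (darcais (n - k)) z)"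
  using assms by (simp add: darcais_rec poly_sum)

end

(* Multiplying the generating function sum sigma(k) q^k by 1 - 3 q kills its q^2 coefficient
   and turns the defining recursion into one with weights d(k) = sigma(k + 1) - 3 sigma(k):
     (m + 1) P(m + 1) = (z + 3 m) P(m) + z * (sum over k = 1..m of d(k) P(m - k)).
   If |z| > kappa m, then |z + 3 m| is at least (1 - 3 / kappa) |z|. Suppose inductively that
   |P(m - k)| <= T^k |P(m)|. Then (m + 1) |P(m + 1)| >= c |z| |P(m)| holds with
   c = 1 - 3 / kappa - sum |d(k)| T^k, and the induction closes if 1 / (c kappa) <= T.
   For T = 2/11 and kappa = 119/11 this means c >= 121/238, i.e. sum |d(k)| T^k <= 51/238. *)
theory Submission
  imports Defs
begin

lemma sigma_code:
  assumes "n > 0"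
  shows "sigma n = sum_list (filter (\<lambda>d. d dvd n) [1..<Suc n])"
proof -
  have "{d. d dvd n} = set (filter (\<lambda>d. d dvd n) [1..<Suc n])"
    using assms by (auto simp: less_Suc_eq_le Suc_le_eq dest: dvd_imp_le intro: dvd_pos_nat)
  then show ?thesis
    by (simp only: sigma_def sum.distinct_set_conv_list distinct_filter distinct_upt map_ident)
qed

lemma sigma_le: "2 * sigma n \<le> n * (n + 1)"
proof (cases "n = 0")
  \<comment> \<open>Every number divides 0, so the sum ranges over an infinite set and is 0 by
    convention.\<close>
  case True
  then show ?thesis
    by (simp add: sigma_def)
next
  case False
  then have "sigma n \<le> \<Sum>{0..n}"
    unfolding sigma_def by (intro sum_mono2) (auto dest: dvd_imp_le)
  then show ?thesis
    using gauss_sum_nat[of n] by simp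
qed

definition sigma_diff :: "nat \<Rightarrow> int" where
  "sigma_diff k = int (sigma (Suc k)) - 3 * int (sigma k)"

text \<open>Subtract 3 times the defining recursion at \<open>m\<close> from the one at
  \<open>Suc m\<close>; the \<open>k = 0\<close> term of the shifted sum supplies
  \<open>z * P(m)\<close>.\<close>

lemma darcais_sigma_diff_rec:
  "of_nat (Suc m) * poly (darcais (Suc m)) z =
     (z + 3 * of_nat m) * poly (darcais m) z +
     z * (\<Sum>k = 1..m. of_int (sigma_diff k) * poly (darcais (m - k)) z)"
proof -
  define p where "p k = poly (darcais k) z" for k
  have sigma_1: "sigma (Suc 0) = 1"
    by (simp add: sigma_def)
  have "of_nat (Suc m) * p (Suc m) = z * (\<Sum>k = 1..Suc m. of_nat (sigma k) * p (Suc m - k))"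
    unfolding p_def by (subst poly_darcais_rec) (simp_all del: of_nat_Suc)
  also have "(\<Sum>k = 1..Suc m. of_nat (sigma k) * p (Suc m - k)) =
      (\<Sum>k = 0..m. of_nat (sigma (Suc k)) * p (m - k))"
    unfolding One_nat_def by (subst sum.shift_bounds_cl_Suc_ivl) simp
  also have "\<dots> = p m + (\<Sum>k = 1..m. of_nat (sigma (Suc k)) * p (m - k))"
    by (simp add: sum.atLeast_Suc_atMost sigma_1)
  finally have Suc_rec: "of_nat (Suc m) * p (Suc m) =
      z * (p m + (\<Sum>k = 1..m. of_nat (sigma (Suc k)) * p (m - k)))" .
  have rec: "of_nat m * p m = z * (\<Sum>k = 1..m. of_nat (sigma k) * p (m - k))"
  proof (cases "m = 0")
    case False
    then show ?thesis
      unfolding p_def by (subst poly_darcais_rec) simp_all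
  qed simp
  have "(\<Sum>k = 1..m. of_int (sigma_diff k) * p (m - k)) =
      (\<Sum>k = 1..m. of_nat (sigma (Suc k)) * p (m - k)) -
      3 * (\<Sum>k = 1..m. of_nat (sigma k) * p (m - k))"
    by (simp add: sigma_diff_def sum_subtractf sum_distrib_left algebra_simps)
  moreover have "(z + 3 * of_nat m) * p m = z * p m + 3 * (of_nat m * p m)"
    by (simp add: algebra_simps)
  ultimately show ?thesis
    unfolding p_def[symmetric] by (simp only: Suc_rec rec) (simp add: algebra_simps)
qed

text \<open>Equality at \<open>k = 8\<close> fixes the constants; afterwards the left side at most
  doubles per step.\<close>

lemma quadratic_le_exp:
  fixes k :: nat
  assumes "k \<ge> 8"
  shows "32 * (k * (k + 1)) \<le> 9 * 2 ^ k"
  using assms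
proof (induction k rule: dec_induct)
  case (step k)
  have "Suc k * (Suc k + 1) \<le> (k + 1) * (2 * k)"
    using step.hyps by (intro mult_le_mono) auto
  then show ?case
    using step.IH by simp
qed simp

text \<open>Both \<open>sigma (Suc k)\<close> and \<open>3 * sigma k\<close> lie between 0 and 3/2 *
  k(k + 1), hence so does the absolute value of their difference; 27/64 is 3/2 * 9/32.\<close>

lemma sigma_diff_le:
  assumes "k \<ge> 8"
  shows "real_of_int \<bar>sigma_diff k\<bar> \<le> 27 / 64 * 2 ^ k"
proof -
  define q where "q = k * (k + 1)"
  note sigma_le[of "Suc k"]
  also have "Suc k * (Suc k + 1) \<le> (k + 1) * (3 * k)"
    using assms by (intro mult_le_mono) auto
  also have "\<dots> = 3 * q"
    by (simp add: q_def)
  finally have "2 * int (sigma (Suc k)) \<le> 3 * int q"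
    by linarith
  moreover have "2 * int (sigma k) \<le> int q"
    using sigma_le[of k] unfolding q_def[symmetric] by linarith
  ultimately have "2 * \<bar>sigma_diff k\<bar> \<le> 3 * int q"
    unfolding sigma_diff_def by (simp add: abs_if)
  moreover have "32 * int q \<le> 9 * 2 ^ k"
    using of_nat_mono[OF quadratic_le_exp[OF assms], where 'a = int]
    unfolding q_def[symmetric] by simp
  ultimately have "64 * \<bar>sigma_diff k\<bar> \<le> 27 * 2 ^ k"
    by simp
  then have "real_of_int (64 * \<bar>sigma_diff k\<bar>) \<le> real_of_int (27 * 2 ^ k)"
    by (simp only: of_int_le_iff)
  then show ?thesis
    by simp
qed

(* The subtracted term dominates the tail: it is the sum of 27/64 * (4/11)^k over all k > m. *)
lemma sum_sigma_diff_le_aux: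
  assumes "m \<ge> 7"
  shows "(\<Sum>k = 1..m. real_of_int \<bar>sigma_diff k\<bar> * (2 / 11) ^ k) \<le>
    51 / 238 - 297 / 448 * (4 / 11) ^ Suc m"
  using assms
proof (induction m rule: dec_induct)
  case base
  \<comment> \<open>Exact values are used up to \<open>k = 7\<close>, where the exponential bound
    does not yet apply; \<open>sigma_diff 7\<close> needs \<open>sigma 8\<close>.\<close>
  have "sigma 1 = 1" "sigma 2 = 3" "sigma 3 = 4" "sigma 4 = 7" "sigma 5 = 6" "sigma 6 = 12"
    "sigma 7 = 8" "sigma 8 = 15"
    by (subst sigma_code; code_simp)+
  then have "sigma_diff 1 = 0" "sigma_diff 2 = -5" "sigma_diff 3 = -5" "sigma_diff 4 = -15"
    "sigma_diff 5 = -6" "sigma_diff 6 = -28" "sigma_diff 7 = -9"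
    by (simp_all add: sigma_diff_def del: One_nat_def)
  moreover have "{1..7::nat} = {1, 2, 3, 4, 5, 6, 7}"
    by auto
  ultimately show ?case
    by (simp add: power_divide)
next
  case (step m)
  have "real_of_int \<bar>sigma_diff (Suc m)\<bar> * (2 / 11) ^ Suc m \<le>
      27 / 64 * 2 ^ Suc m * (2 / 11) ^ Suc m"
    using step.hyps by (intro mult_right_mono sigma_diff_le) auto
  also have "\<dots> = 27 / 64 * (4 / 11) ^ Suc m"
    by (simp only: mult.assoc power_mult_distrib[symmetric]) simp
  \<comment> \<open>The new term is absorbed exactly: 27/64 + 297/448 * 4/11 = 297/448.\<close>
  finally show ?case
    using step.IH by simp
qed

lemma sum_sigma_diff_le:
  "(\<Sum>k = 1..m. real_of_int \<bar>sigma_diff k\<bar> * (2 / 11) ^ k) \<le> 51 / 238"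
proof -
  have "(\<Sum>k = 1..m. real_of_int \<bar>sigma_diff k\<bar> * (2 / 11) ^ k) \<le>
      (\<Sum>k = 1..max m 7. real_of_int \<bar>sigma_diff k\<bar> * (2 / 11) ^ k)"
    by (intro sum_mono2) auto
  also have "\<dots> \<le> 51 / 238 - 297 / 448 * (4 / 11) ^ Suc (max m 7)"
    by (rule sum_sigma_diff_le_aux) simp
  finally show ?thesis
    by (rule order_trans) simp
qed

text \<open>For nonzero \<open>z\<close> this carries nonvanishing from \<open>m\<close> to
  \<open>Suc m\<close>. Strong induction supplies the ratio bound at every smaller index, since the
  hypothesis on \<open>z\<close> weakens as \<open>m\<close> decreases.\<close>

lemma norm_darcais_Suc_ge:
  fixes z :: complex
  assumes z: "norm z \<ge> 119 / 11 * real m"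
  shows "121 / 238 * norm z * norm (poly (darcais m) z) \<le>
    real (Suc m) * norm (poly (darcais (Suc m)) z)"
  using assms
proof (induction m rule: less_induct)
  case (less m)
  define p where "p k = poly (darcais k) z" for k
  have ratio: "norm (p i) \<le> 2 / 11 * norm (p (Suc i))" if "i < m" for i
  proof (cases "z = 0")
    case True
    with less.prems that show ?thesis
      by simp
  next
    case False
    have "119 / 11 * real (Suc i) \<le> norm z"
      using less.prems that by (intro order_trans[OF _ less.prems] mult_left_mono) auto
    then have "121 / 238 * norm z * norm (p i) \<le> real (Suc i) * norm (p (Suc i))"
      and "real (Suc i) \<le> 11 / 119 * norm z"
      using less.IH[OF that] by (simp_all add: p_def)
    then have "121 / 238 * norm z * norm (p i) \<le> 11 / 119 * norm z * norm (p (Suc i))"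
      by (meson mult_right_mono norm_ge_zero order_trans)
    \<comment> \<open>The ratio is (11/119) / (121/238) = 2/11.\<close>
    then have "norm z * norm (p i) \<le> norm z * (2 / 11 * norm (p (Suc i)))"
      by simp
    then show ?thesis
      using False by (metis mult_le_cancel_left_pos zero_less_norm_iff)
  qed
  have geometric: "norm (p (m - k)) \<le> (2 / 11) ^ k * norm (p m)" if "k \<le> m" for k
    using that
  proof (induction k)
    case (Suc k)
    then have "norm (p (m - Suc k)) \<le> 2 / 11 * norm (p (m - k))"
      using ratio[of "m - Suc k"] by (simp add: Suc_diff_Suc)
    with Suc show ?case
      by simp
  qed simp
  define S where "S = (\<Sum>k = 1..m. of_int (sigma_diff k) * p (m - k))"
  have "norm S \<le> (\<Sum>k = 1..m. real_of_int \<bar>sigma_diff k\<bar> * (2 / 11) ^ k * norm (p m))"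
    unfolding S_def
    by (rule sum_norm_le) (auto simp: norm_mult mult.assoc intro!: mult_left_mono geometric)
  also have "\<dots> \<le> 51 / 238 * norm (p m)"
    unfolding sum_distrib_right[symmetric] by (intro mult_right_mono sum_sigma_diff_le) simp
  finally have "norm z * norm S \<le> norm z * (51 / 238 * norm (p m))"
    by (intro mult_left_mono) auto
  \<comment> \<open>Here 86/119 = 1 - 3 * 11/119; subtracting 51/238 then leaves 121/238.\<close>
  moreover have "86 / 119 * norm z * norm (p m) \<le> norm (z + 3 * of_nat m) * norm (p m)"
    using norm_diff_ineq[of z "3 * of_nat m"] less.prems
    by (intro mult_right_mono) (auto simp: norm_mult)
  moreover have "norm ((z + 3 * of_nat m) * p m) - norm (z * S) \<le>
      norm (of_nat (Suc m) * p (Suc m))"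
    unfolding p_def S_def darcais_sigma_diff_rec by (rule norm_diff_ineq)
  ultimately show ?case
    unfolding p_def[symmetric] norm_mult norm_of_nat by simp
qed

theorem corollary3:
  fixes n :: nat and z :: complex and \<kappa> :: real
  assumes "\<kappa> = 119 / 11"
    and "n \<ge> 1"
    and "norm z > \<kappa> * (real n - 1)"
  shows "poly (darcais n) z \<noteq> 0"
proof -
  have "\<kappa> * (real n - 1) \<ge> 0"
    using assms by simp
  with assms(3) have "norm z > 0"
    by linarith
  then have "z \<noteq> 0"
    by simp
  \<comment> \<open>With \<open>n\<close> fixed, each step from \<open>m\<close> to
    \<open>Suc m\<close> has \<open>m\<close> at most \<open>n - 1\<close>, so the one bound on
    \<open>z\<close> serves them all.\<close>
  have "poly (darcais m) z \<noteq> 0" if "m \<le> n" for m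
    using that
  proof (induction m)
    case 0
    then show ?case
      by (simp add: darcais_0)
  next
    case (Suc m)
    have "119 / 11 * real m \<le> \<kappa> * (real n - 1)"
      unfolding assms(1) using Suc.prems by (intro mult_left_mono) auto
    also have "\<dots> \<le> norm z"
      using assms(3) by simp
    finally have "119 / 11 * real m \<le> norm z" .
    from norm_darcais_Suc_ge[OF this] Suc \<open>z \<noteq> 0\<close> show ?case
      by (auto simp: mult_le_0_iff)
  qed
  then show ?thesis
    by simp
qed

end
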